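(* Let $A$ and $B$ be polynomials with complex coefficients of degree at least two, and let $X$ be a non-constant polynomial such that $A\circ X=X\circ B$. Then for any decomposition $X=X_1\circ X_2$ with $X_1,X_2$ polynomials, there exists a polynomial $C$ such that $$A\circ X_1=X_1\circ C,\qquad C\circ X_2=X_2\circ B.$$ *)

theory Defs
  imports "HOL-Computational_Algebra.Computational_Algebra" Complex_Main
begin

end

theory Submission
  imports Defs
begin

text \<open>
  The equation \<open>A \<circ> X = X \<circ> B\<close> has the form \<open>U \<circ> X\<^sub>2 = X\<^sub>1 \<circ> S\<close> with \<open>U = A \<circ> X\<^sub>1\<close> and
  \<open>S = X\<^sub>2 \<circ> B\<close>, and \<open>deg X\<^sub>2\<close> divides \<open>deg S\<close>. Everything rests on showing that these two facts
  force \<open>S = C \<circ> X\<^sub>2\<close> for some \<open>C\<close> (lemma \<open>pcompose_right_factor\<close>). Then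
  \<open>A \<circ> X\<^sub>1 \<circ> X\<^sub>2 = X\<^sub>1 \<circ> C \<circ> X\<^sub>2\<close>, and the non-constant \<open>X\<^sub>2\<close> can be cancelled on the right.

  To find \<open>C\<close>, approximate \<open>S\<close> by polynomials in \<open>X\<^sub>2\<close>, choosing \<open>C\<close> so that the degree of the
  error \<open>R = S - C \<circ> X\<^sub>2\<close> is as small as possible. Unless \<open>R\<close> is constant, its degree cannot be a
  multiple of \<open>deg X\<^sub>2\<close>, because otherwise its leading term could be removed by a suitable
  \<open>c X\<^sub>2\<^sup>k\<close>. On the other hand \<open>X\<^sub>1 \<circ> S - X\<^sub>1 \<circ> (C \<circ> X\<^sub>2)\<close> is a polynomial in \<open>X\<^sub>2\<close>, so its degree is
  a multiple of \<open>deg X\<^sub>2\<close>; and if \<open>deg R < deg S\<close> then, in characteristic zero, that degree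
  equals \<open>deg R + (deg X\<^sub>1 - 1) deg S\<close> (lemma \<open>degree_pcompose_diff\<close>). As \<open>deg X\<^sub>2\<close> divides \<open>deg S\<close>, it divides \<open>deg R\<close> as well. Hence
  \<open>R\<close> is a constant, which can be absorbed into \<open>C\<close>.
\<close>

text \<open>
  For \<open>P = z\<^sup>k\<close> the quotient \<open>K = (u\<^sup>k - v\<^sup>k) / (u - v)\<close> is the sum of the \<open>k\<close> products \<open>u\<^sup>i v\<^sup>j\<close>
  with \<open>i + j = k - 1\<close>. When \<open>u\<close> and \<open>v\<close> have the same leading term, these products all have the
  same leading term too, which produces the factor \<open>deg P\<close> in the top coefficient. The induction
  avoids these sums by means of \<open>u p(u) - v p(v) = (u - v) p(u) + v (p(u) - p(v))\<close>.
\<close>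

lemma pcompose_diff_factor:
  fixes P u v :: "'a::idom poly"
  assumes pos: "degree u > 0"
    and deg: "degree v = degree u" and lead: "lead_coeff v = lead_coeff u"
  shows "\<exists>K. pcompose P u - pcompose P v = (u - v) * K
           \<and> degree K \<le> (degree P - 1) * degree u
           \<and> coeff K ((degree P - 1) * degree u)
               = of_nat (degree P) * lead_coeff P * lead_coeff u ^ (degree P - 1)"
proof (induction P)
  case 0
  show ?case by (rule exI[of _ 0]) simp
next
  case (pCons a p)
  let ?m = "degree u" and ?l = "lead_coeff u"
  show ?case
  proof (cases "degree p = 0")
    case True
    then obtain c where p: "p = [:c:]" by (elim degree_eq_zeroE)
    show ?thesis
      by (rule exI[of _ "[:c:]"]) (simp add: p pcompose_pCons smult_diff_right)
  next
    case False
    then obtain j where j: "degree p = Suc j" by (cases "degree p") auto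
    from pCons.IH obtain K where K:
      "pcompose p u - pcompose p v = (u - v) * K" "degree K \<le> j * ?m"
      "coeff K (j * ?m) = of_nat (Suc j) * lead_coeff p * ?l ^ j"
      unfolding j by auto
    let ?K = "pcompose p u + v * K"
    have degP: "degree (pCons a p) = Suc (Suc j)"
      using j False by (auto simp: degree_pCons_eq_if)
    have comp: "degree (pcompose p u) = Suc j * ?m"
      by (simp add: degree_pcompose j)
    have vK: "degree (v * K) \<le> Suc j * ?m"
      using degree_mult_le[of v K] K(2) deg by simp
    have "coeff (pcompose p u) (Suc j * ?m) = lead_coeff p * ?l ^ Suc j"
      using lead_coeff_comp[OF pos, of p] comp j by simp
    moreover have "coeff (v * K) (Suc j * ?m) = ?l * coeff K (j * ?m)"
    proof (cases "degree K = j * ?m")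
      case True
      then show ?thesis using coeff_mult_degree_sum[of v K] deg lead by simp
    next
      case False
      then have "degree (v * K) < Suc j * ?m"
        using degree_mult_le[of v K] K(2) deg by simp
      then show ?thesis using False K(2) by (simp add: coeff_eq_0)
    qed
    ultimately have top: "coeff ?K (Suc j * ?m)
        = of_nat (Suc (Suc j)) * lead_coeff p * ?l ^ Suc j"
      using K(3) by (simp add: algebra_simps)
    have "pcompose (pCons a p) u - pcompose (pCons a p) v
        = (u - v) * pcompose p u + v * (pcompose p u - pcompose p v)"
      by (simp add: pcompose_pCons algebra_simps)
    also have "\<dots> = (u - v) * ?K"
      unfolding K(1) by (simp add: algebra_simps)
    finally have eq: "pcompose (pCons a p) u - pcompose (pCons a p) v = (u - v) * ?K" .
    have "degree ?K \<le> Suc j * ?m"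
      by (rule degree_add_le) (use comp vK in auto)
    moreover have "lead_coeff (pCons a p) = lead_coeff p"
      using j degP by simp
    ultimately show ?thesis
      using eq top degP by (intro exI[of _ ?K]) simp
  qed
qed

text \<open>
  Characteristic zero enters here: the factor \<open>deg P\<close> in the top coefficient of the quotient must
  not vanish. In characteristic \<open>p\<close> the formula fails for \<open>P = z\<^sup>p\<close>, where
  \<open>P(u) - P(v) = (u - v)\<^sup>p\<close>.
\<close>

lemma degree_pcompose_diff:
  fixes P u v :: "'a::field_char_0 poly"
  assumes "degree P > 0" and "u \<noteq> v" and small: "degree (u - v) < degree u"
  shows "degree (pcompose P u - pcompose P v)
           = degree (u - v) + (degree P - 1) * degree u"
proof -
  have v: "v = u + (v - u)" by simp
  have small': "degree (v - u) < degree u"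
    using small by (metis degree_minus minus_diff_eq)
  have deg: "degree v = degree u"
    using degree_add_eq_left[OF small'] v by simp
  have lead: "lead_coeff v = lead_coeff u"
    using coeff_eq_0[OF small'] deg by simp
  obtain K where K: "pcompose P u - pcompose P v = (u - v) * K"
      "degree K \<le> (degree P - 1) * degree u"
      "coeff K ((degree P - 1) * degree u)
         = of_nat (degree P) * lead_coeff P * lead_coeff u ^ (degree P - 1)"
    using pcompose_diff_factor[of u v P] deg lead small by auto
  have "lead_coeff P \<noteq> 0" "lead_coeff u \<noteq> 0"
    using assms(1) small by auto
  then have nz: "coeff K ((degree P - 1) * degree u) \<noteq> 0"
    using K(3) assms(1) by simp
  then have "degree K = (degree P - 1) * degree u"
    using K(2) le_degree[OF nz] by simp
  moreover have "K \<noteq> 0" using nz by auto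
  ultimately show ?thesis
    using assms(2) K(1) by (simp add: degree_mult_eq)
qed

lemma pcompose_reduce_degree:
  fixes Q R :: "'a::field poly"
  assumes "degree Q > 0" and "degree R > 0" and "degree Q dvd degree R"
  obtains c where "degree (R - pcompose c Q) < degree R"
proof -
  obtain k where k: "degree R = k * degree Q"
    using assms(3) by (auto simp: dvd_def mult.commute)
  have Q: "lead_coeff Q \<noteq> 0" using assms(1) by auto
  have R: "lead_coeff R \<noteq> 0" using assms(2) by auto
  define c where "c = monom (lead_coeff R / lead_coeff Q ^ k) k"
  have dc: "degree c = k" using Q R by (simp add: c_def degree_monom_eq)
  have deg: "degree (pcompose c Q) = degree R"
    by (simp add: degree_pcompose dc k)
  have "lead_coeff (pcompose c Q) = lead_coeff R"
    using lead_coeff_comp[OF assms(1), of c] Q dc by (simp add: c_def)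
  then have "coeff (R - pcompose c Q) (degree R) = 0"
    using deg by simp
  moreover have "degree (R - pcompose c Q) \<le> degree R"
    by (rule degree_diff_le) (use deg in auto)
  ultimately have "degree (R - pcompose c Q) < degree R"
    using eq_zero_or_degree_less assms(2) by fastforce
  then show ?thesis by (rule that)
qed

text \<open>
  The best approximation of \<open>S\<close> by a polynomial in \<open>Q\<close> has an error whose degree is a multiple of
  \<open>deg Q\<close>, so it could be improved unless the error is constant. The divisibility assumption
  excludes cases such as \<open>z\<^sup>3 \<circ> z\<^sup>2 = z\<^sup>2 \<circ> z\<^sup>3\<close>, where \<open>S = z\<^sup>3\<close> is not a polynomial in
  \<open>Q = z\<^sup>2\<close>.
\<close>

lemma pcompose_right_factor:
  fixes P Q S U :: "'a::field_char_0 poly"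
  assumes eq: "pcompose U Q = pcompose P S"
    and P: "degree P > 0" and Q: "degree Q > 0" and dvd: "degree Q dvd degree S"
  obtains C where "S = pcompose C Q"
proof -
  obtain C where least: "\<And>D. degree (S - pcompose C Q) \<le> degree (S - pcompose D Q)"
    using ex_has_least_nat[of "\<lambda>_. True" _ "\<lambda>D. degree (S - pcompose D Q)"] by auto
  define R where "R = S - pcompose C Q"
  have "degree R = 0"
  proof (rule ccontr)
    assume R: "degree R \<noteq> 0"
    have "degree Q dvd degree R"
    proof (cases "degree R < degree S")
      case True
      \<comment> \<open>A polynomial in \<open>Q\<close> whose degree is also known in terms of \<open>deg R\<close>.\<close>
      have "pcompose P S - pcompose P (pcompose C Q) = pcompose (U - pcompose P C) Q"
        by (simp add: pcompose_diff pcompose_assoc eq)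
      moreover have "S \<noteq> pcompose C Q" using R by (auto simp: R_def)
      ultimately have "degree R + (degree P - 1) * degree S
                   = degree (U - pcompose P C) * degree Q"
        using degree_pcompose_diff[OF P, of S "pcompose C Q"] True
        by (simp add: R_def degree_pcompose)
      then show ?thesis
        using dvd by (metis dvd_add_left_iff dvd_mult dvd_triv_right)
    next
      case False
      \<comment> \<open>Comparison with the approximation \<open>0\<close> shows that the error has degree at most \<open>deg S\<close>.\<close>
      with least[of 0] have "degree R = degree S" by (simp add: R_def)
      with dvd show ?thesis by simp
    qed
    with R Q obtain c where "degree (R - pcompose c Q) < degree R"
      using pcompose_reduce_degree[of Q R] by auto
    then show False
      using least[of "C + c"] by (simp add: R_def pcompose_add algebra_simps)
  qed
  then obtain r where "R = [:r:]" by (elim degree_eq_zeroE)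
  then have "S = pcompose (C + [:r:]) Q"
    by (simp add: R_def pcompose_add algebra_simps)
  then show ?thesis by (rule that)
qed

theorem corollary3p4:
  fixes A B X :: "complex poly"
  assumes "degree A \<ge> 2" and "degree B \<ge> 2"
    and "degree X > 0"
    and "pcompose A X = pcompose X B"
  shows "\<forall>X\<^sub>1 X\<^sub>2 :: complex poly. X = pcompose X\<^sub>1 X\<^sub>2 \<longrightarrow>
    (\<exists>C :: complex poly. pcompose A X\<^sub>1 = pcompose X\<^sub>1 C \<and> pcompose C X\<^sub>2 = pcompose X\<^sub>2 B)"
proof (intro allI impI)
  fix X\<^sub>1 X\<^sub>2 :: "complex poly"
  assume X: "X = pcompose X\<^sub>1 X\<^sub>2"
  have pos: "degree X\<^sub>1 > 0" "degree X\<^sub>2 > 0"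
    using assms(3) by (auto simp: X degree_pcompose)
  have eq: "pcompose (pcompose A X\<^sub>1) X\<^sub>2 = pcompose X\<^sub>1 (pcompose X\<^sub>2 B)"
    using assms(4) by (simp add: X pcompose_assoc)
  obtain C where C: "pcompose X\<^sub>2 B = pcompose C X\<^sub>2"
    using pcompose_right_factor[OF eq pos] by (auto simp: degree_pcompose)
  have "pcompose (pcompose A X\<^sub>1 - pcompose X\<^sub>1 C) X\<^sub>2 = 0"
    using eq by (simp add: C pcompose_diff pcompose_assoc)
  then have "pcompose A X\<^sub>1 = pcompose X\<^sub>1 C"
    using pcompose_eq_0[OF _ pos(2)] by (metis eq_iff_diff_eq_0)
  with C show "\<exists>C. pcompose A X\<^sub>1 = pcompose X\<^sub>1 C \<and> pcompose C X\<^sub>2 = pcompose X\<^sub>2 B"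
    by metis
qed

end
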